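(* Let $G = \{G_1, \ldots, G_n\}$ with $n \ge 1$. Assume that for every $j \ge 2$, the option $G_j = \{G_{j1}, \ldots, G_{jm_j}\}$ has some option $G_{j\ell}$ with $G_{j\ell} \equiv \{G_1\}$. Then $G \equiv \{G_1\}$.
   Context: Positions are defined recursively: $*L$ and $*R$ are terminal positions; if $G_1,\dots,G_n$ ($n\ge 1$) are positions, then $\{G_1,\dots,G_n\}$ is a position with options $G_1,\dots,G_n$ (so $\{G_1\}$ is the position whose only option is $G_1$). All positions have finite game trees. Play: Left and Right move alternately, each choosing any option of the current position; when a terminal position is reached, Left wins if it is $*L$ and Right wins if it is $*R$. Disjunctive sum: $*L + *L = *R + *R = *L$, $*L + *R = *R + *L = *R$; if at least one of $G,H$ is non-terminal, $G+H$ has options all $G'+H$ ($G'$ an option of $G$) and all $G+H'$ ($H'$ an option of $H$). Outcome classes: $\mathcal{L}$ (Left wins moving first or second), $\mathcal{R}$ (Right wins moving first or second), $\mathcal{N}$ (first player wins), $\mathcal{P}$ (second player wins); $o(G)$ denotes the outcome class. Equivalence: $G \equiv H$ iff $o(G+X) = o(H+X)$ for every position $X$. *)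

theory Defs
  imports Main "HOL-Library.FSet"
begin

datatype player = Left | Right

fun opponent :: "player \<Rightarrow> player" where
  "opponent Left = Right"
| "opponent Right = Left"

text \<open>The datatype also contains \<open>Opts {||}\<close>, which is not a position; the predicate
  \<open>position\<close> below excludes it hereditarily.\<close>

datatype game_tree = StarL | StarR | Opts "game_tree fset"

inductive position :: "game_tree \<Rightarrow> bool" where
  "position StarL"
| "position StarR"
| "\<lbrakk>Gs \<noteq> {||}; \<And>G. G |\<in>| Gs \<Longrightarrow> position G\<rbrakk> \<Longrightarrow> position (Opts Gs)"

fun options :: "game_tree \<Rightarrow> game_tree fset" where
  "options StarL = {||}"
| "options StarR = {||}"
| "options (Opts Gs) = Gs"

lemma size_option_less: "G' |\<in>| options G \<Longrightarrow> size G' < size G"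
proof (cases G)
  case (Opts Gs)
  assume "G' |\<in>| options G"
  then have "Suc (size G') \<le> (\<Sum>x\<in>fset Gs. Suc (size x))"
    using Opts by (intro member_le_sum) auto
  then show ?thesis using Opts by simp
qed auto

lemma size_Opts: "G |\<in>| Gs \<Longrightarrow> size G < size (Opts Gs)"
  using size_option_less[of G "Opts Gs"] by simp

text \<open>\<open>wins p q G\<close>: player \<open>p\<close> can force a win from \<open>G\<close> when player \<open>q\<close> is to move.\<close>

function wins :: "player \<Rightarrow> player \<Rightarrow> game_tree \<Rightarrow> bool" where
  "wins p q StarL \<longleftrightarrow> p = Left"
| "wins p q StarR \<longleftrightarrow> p = Right"
| "wins p q (Opts Gs) \<longleftrightarrow>
    (if p = q then fBex Gs (\<lambda>G. wins p (opponent q) G)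
     else fBall Gs (\<lambda>G. wins p (opponent q) G))"
  by pat_completeness auto
termination
  by (relation "measure (\<lambda>(p, q, G). size G)") (auto simp only: in_measure prod.case intro: size_Opts)

datatype outcome_class = OutL | OutR | OutN | OutP

definition outcome :: "game_tree \<Rightarrow> outcome_class" where
  "outcome G =
    (if wins Left Left G \<and> wins Left Right G then OutL
     else if wins Right Left G \<and> wins Right Right G then OutR
     else if wins Left Left G \<and> wins Right Right G then OutN
     else OutP)"

lemma wins_determined: "wins (opponent p) q G \<longleftrightarrow> \<not> wins p q G"
proof (induction G arbitrary: q)
  case (Opts Gs)
  have "opponent p = q \<longleftrightarrow> p \<noteq> q" by (cases p; cases q) auto
  then show ?case using Opts by auto
qed (cases p; simp)+

text \<open>By determinacy the final \<open>else\<close> branch of \<open>outcome\<close> is the class of second-player wins.\<close>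

lemma outcome_iffs:
  "outcome G = OutL \<longleftrightarrow> wins Left Left G \<and> wins Left Right G"
  "outcome G = OutR \<longleftrightarrow> wins Right Left G \<and> wins Right Right G"
  "outcome G = OutN \<longleftrightarrow> wins Left Left G \<and> wins Right Right G"
  "outcome G = OutP \<longleftrightarrow> wins Right Left G \<and> wins Left Right G"
  using wins_determined[of Left _ G] by (auto simp: outcome_def)

declare fimage_cong [fundef_cong]

function (sequential) game_sum :: "game_tree \<Rightarrow> game_tree \<Rightarrow> game_tree" (infixl "\<oplus>" 65) where
  "StarL \<oplus> StarL = StarL"
| "StarR \<oplus> StarR = StarL"
| "StarL \<oplus> StarR = StarR"
| "StarR \<oplus> StarL = StarR"
| "G \<oplus> H = Opts ((\<lambda>G'. G' \<oplus> H) |`| options G |\<union>| (\<lambda>H'. G \<oplus> H') |`| options H)"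
  by pat_completeness auto
termination
  by (relation "measure (\<lambda>(G, H). size G + size H)")
    (auto simp only: in_measure prod.case options.simps fempty_iff
      dest: size_option_less size_Opts intro: add_strict_left_mono add_strict_right_mono)

text \<open>The equation for non-terminal sums loops as a rewrite rule.\<close>

declare game_sum.simps(5-) [simp del]

lemma position_option: "position G \<Longrightarrow> G' |\<in>| options G \<Longrightarrow> position G'"
  by (induction rule: position.induct) auto

lemma position_Opts_iff [simp]:
  "position (Opts Gs) \<longleftrightarrow> Gs \<noteq> {||} \<and> (\<forall>G. G |\<in>| Gs \<longrightarrow> position G)"
  by (subst position.simps) auto

lemma position_game_sum: "position G \<Longrightarrow> position H \<Longrightarrow> position (G \<oplus> H)"
proof (induction "size G + size H" arbitrary: G H rule: less_induct)
  case less
  have L: "position (G' \<oplus> H)" if "G' |\<in>| options G" for G'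
    using less.hyps[of G' H] less.prems position_option[OF _ that] size_option_less[OF that]
    by linarith
  have R: "position (G \<oplus> H')" if "H' |\<in>| options H" for H'
    using less.hyps[of G H'] less.prems position_option[OF _ that] size_option_less[OF that]
    by linarith
  show ?case
  proof (cases "options G = {||} \<and> options H = {||}")
    case True
    then have "G \<in> {StarL, StarR}" "H \<in> {StarL, StarR}"
      using less.prems by (cases G; cases H; simp)+
    then show ?thesis by (auto simp: position.intros(1,2))
  next
    case False
    let ?O = "(\<lambda>G'. G' \<oplus> H) |`| options G |\<union>| (\<lambda>H'. G \<oplus> H') |`| options H"
    have "G \<oplus> H = Opts ?O"
    proof (cases G)
      case (Opts Gs)
      show ?thesis unfolding Opts by (rule game_sum.simps)
    next
      case StarL
      with False obtain Hs where "H = Opts Hs" by (cases H) auto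
      show ?thesis unfolding \<open>H = Opts Hs\<close> by (rule game_sum.simps)
    next
      case StarR
      with False obtain Hs where "H = Opts Hs" by (cases H) auto
      show ?thesis unfolding \<open>H = Opts Hs\<close> by (rule game_sum.simps)
    qed
    moreover have "position (Opts ?O)"
    proof (rule position.intros(3))
      show "?O \<noteq> {||}" using False by simp
    qed (use L R in blast)
    ultimately show ?thesis by (rule ssubst)
  qed
qed

definition game_equiv :: "game_tree \<Rightarrow> game_tree \<Rightarrow> bool" (infix "\<cong>" 50) where
  "G \<cong> H \<longleftrightarrow> (\<forall>X. position X \<longrightarrow> outcome (G \<oplus> X) = outcome (H \<oplus> X))"

end

theory Submission
  imports Defs
begin

text \<open>Moving from \<open>G\<close> to \<open>g j\<close> with \<open>j \<ge> 2\<close> is reversible: the opponent answers by moving to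
  \<open>K \<cong> Opts {|g 1|}\<close>. Hence a player who wins \<open>Opts {|g 1|} \<oplus> X\<close> also wins \<open>G \<oplus> X\<close>, with the same
  player to move, by induction on \<open>X\<close>; determinacy gives the converse.\<close>

lemma opponent_opponent [simp]: "opponent (opponent p) = p"
  by (cases p) auto

lemma opponent_neq [simp]: "opponent p \<noteq> p" "p \<noteq> opponent p"
  by (cases p; simp)+

lemma neq_opponent_conv: "p \<noteq> q \<longleftrightarrow> q = opponent p"
  by (cases p; cases q) auto

text \<open>Determinacy makes Right's results the negations of Left's, so the four classes are
  exactly the four combinations of Left's results for the two possible movers.\<close>

lemma outcome_eq_iff: "outcome G = outcome H \<longleftrightarrow> (\<forall>p q. wins p q G = wins p q H)"
proof
  assume eq: "outcome G = outcome H"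
  have "wins Left q G = wins Left q H" for q
    using eq outcome_iffs[of G] outcome_iffs[of H]
      wins_determined[of Left _ G] wins_determined[of Left _ H]
    by (cases q; cases "outcome H") auto
  then show "\<forall>p q. wins p q G = wins p q H"
    using wins_determined[of Left] by (metis opponent.simps(1) player.exhaust)
qed (simp add: outcome_def)

text \<open>One direction suffices because it is assumed for both players: if \<open>p\<close> does
  not win \<open>G\<close>, the opponent wins \<open>G\<close>, hence \<open>H\<close>, so
  \<open>p\<close> does not win \<open>H\<close>.\<close>

lemma wins_imp_outcome_eq:
  assumes "\<And>p q. wins p q G \<Longrightarrow> wins p q H"
  shows "outcome G = outcome H"
  unfolding outcome_eq_iff using assms wins_determined by blast

lemma game_equiv_wins:
  "G \<cong> H \<Longrightarrow> position X \<Longrightarrow> wins p q (G \<oplus> X) = wins p q (H \<oplus> X)"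
  by (auto simp: game_equiv_def outcome_eq_iff)

text \<open>Sequential matching splits the catch-all equation of the sum by constructor patterns;
  the case analysis exposes a pattern that fits.\<close>

lemma game_sum_nonterminal:
  assumes "options G \<noteq> {||} \<or> options H \<noteq> {||}"
  shows "G \<oplus> H = Opts ((\<lambda>G'. G' \<oplus> H) |`| options G |\<union>| (\<lambda>H'. G \<oplus> H') |`| options H)"
proof (cases G)
  case (Opts Gs)
  show ?thesis unfolding Opts by (rule game_sum.simps)
next
  case StarL
  with assms obtain Hs where H: "H = Opts Hs" by (cases H) auto
  show ?thesis unfolding H by (rule game_sum.simps)
next
  case StarR
  with assms obtain Hs where H: "H = Opts Hs" by (cases H) auto
  show ?thesis unfolding H by (rule game_sum.simps)
qed

lemma wins_sum_own_move:
  assumes "options G \<noteq> {||} \<or> options H \<noteq> {||}"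
  shows "wins p p (G \<oplus> H) \<longleftrightarrow>
    (\<exists>G'. G' |\<in>| options G \<and> wins p (opponent p) (G' \<oplus> H)) \<or>
    (\<exists>H'. H' |\<in>| options H \<and> wins p (opponent p) (G \<oplus> H'))"
  by (subst game_sum_nonterminal[OF assms]) auto

lemma wins_sum_opponent_move:
  assumes "options G \<noteq> {||} \<or> options H \<noteq> {||}"
  shows "wins p (opponent p) (G \<oplus> H) \<longleftrightarrow>
    (\<forall>G'. G' |\<in>| options G \<longrightarrow> wins p p (G' \<oplus> H)) \<and>
    (\<forall>H'. H' |\<in>| options H \<longrightarrow> wins p p (G \<oplus> H'))"
  by (subst game_sum_nonterminal[OF assms]) auto

lemma wins_sum_reversible:
  assumes A: "A |\<in>| Gs"
    and rev: "\<And>B. B |\<in>| Gs \<Longrightarrow> B \<noteq> A \<Longrightarrow> \<exists>K. K |\<in>| options B \<and> K \<cong> Opts {|A|}"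
    and "position X" "wins p q (Opts {|A|} \<oplus> X)"
  shows "wins p q (Opts Gs \<oplus> X)"
  using assms(3,4)
proof (induction "size X" arbitrary: X q rule: less_induct)
  case less
  \<comment> \<open>Moves inside \<open>X\<close> are shared by both sums; they pass the turn, so
    the mover must vary in the induction.\<close>
  have IH: "wins p r (Opts Gs \<oplus> X')" if "X' |\<in>| options X" "wins p r (Opts {|A|} \<oplus> X')" for X' r
    using less.hyps[OF size_option_less] less.prems(1) position_option that by blast
  have ne: "options (Opts {|A|}) \<noteq> {||} \<or> options X \<noteq> {||}"
      "options (Opts Gs) \<noteq> {||} \<or> options X \<noteq> {||}"
    using A by auto
  show ?case
  proof (cases "p = q")
    \<comment> \<open>A winning move to \<open>A\<close> is also available from
      \<open>Opts Gs\<close>; a winning move in \<open>X\<close> is covered by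
      \<open>IH\<close>.\<close>
    case True
    then show ?thesis
      using less.prems(2) A IH by (auto simp: wins_sum_own_move[OF ne(1)] wins_sum_own_move[OF ne(2)])
  next
    case False
    then have q: "q = opponent p" by (simp add: neq_opponent_conv)
    have "wins p p (B \<oplus> X)" if B: "B |\<in>| Gs" for B
    proof (cases "B = A")
      case True
      \<comment> \<open>The opponent could already move to \<open>A\<close> in
        \<open>Opts {|A|}\<close>, so the assumed win covers this reply.\<close>
      then show ?thesis using less.prems(2) by (simp add: q wins_sum_opponent_move[OF ne(1)])
    next
      case False
      then obtain K where K: "K |\<in>| options B" "K \<cong> Opts {|A|}" using rev B by blast
      \<comment> \<open>After the answer \<open>K\<close> the opponent is to move again, just as in
        the assumed win of \<open>Opts {|A|} \<oplus> X\<close>, so the equivalence transfers that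
        win.\<close>
      then have "wins p (opponent p) (K \<oplus> X)"
        using game_equiv_wins less.prems q by blast
      moreover have "options B \<noteq> {||} \<or> options X \<noteq> {||}" using K(1) by auto
      ultimately show ?thesis using K(1) by (auto simp: wins_sum_own_move)
    qed
    then show ?thesis
      using less.prems(2) IH
      by (simp add: q wins_sum_opponent_move[OF ne(1)] wins_sum_opponent_move[OF ne(2)])
  qed
qed

theorem theorem3p10:
  fixes G :: game_tree and g :: "nat \<Rightarrow> game_tree" and n :: nat
  assumes "n \<ge> 1"
    and "\<And>j. j \<in> {1..n} \<Longrightarrow> position (g j)"
    and "G = Opts (g |`| fset_of_list [1..<Suc n])"
    and "\<And>j. j \<in> {2..n} \<Longrightarrow> \<exists>K. K |\<in>| options (g j) \<and> K \<cong> Opts {|g 1|}"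
  shows "G \<cong> Opts {|g 1|}"
proof -
  let ?Gs = "g |`| fset_of_list [1..<Suc n]"
  have mem: "B |\<in>| ?Gs \<longleftrightarrow> (\<exists>j\<in>{1..n}. B = g j)" for B
    by (auto simp: fset_of_list_elem simp del: upt_Suc)
  have A: "g 1 |\<in>| ?Gs" using \<open>n \<ge> 1\<close> unfolding mem by auto
  have rev: "\<exists>K. K |\<in>| options B \<and> K \<cong> Opts {|g 1|}" if "B |\<in>| ?Gs" "B \<noteq> g 1" for B
  proof -
    obtain j where j: "j \<in> {1..n}" "B = g j" using \<open>B |\<in>| ?Gs\<close> unfolding mem by blast
    \<comment> \<open>Options are compared by value, so a repetition of \<open>g 1\<close> at a
      later index does no harm.\<close>
    then have "j \<noteq> 1" using \<open>B \<noteq> g 1\<close> by blast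
    then have "j \<in> {2..n}" using j(1) by auto
    then show ?thesis using assms(4) j(2) by blast
  qed
  have "outcome (Opts {|g 1|} \<oplus> X) = outcome (Opts ?Gs \<oplus> X)" if "position X" for X
    by (rule wins_imp_outcome_eq) (rule wins_sum_reversible[OF A rev that])
  then show ?thesis unfolding game_equiv_def assms(3) by simp
qed

end
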